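(* Let $(X,\|\cdot\|)$ be a normed vector space over $\mathbb{R}$ or $\mathbb{C}$ with $X\neq\{0\}$, and let $\varrho$ be the metric induced by $\|\cdot\|$, i.e. $\varrho(x,y)=\|x-y\|$. Then there exists a Markov-Feller semigroup $(\mathscr{P}_t:\mathcal{M}_\varrho(X)\to\mathcal{M}_\varrho(X))_{t\ge 0}$ such that, for every $y\in X$, the semigroup $(\mathscr{P}_t)_{t\ge 0}$ has the asymptotic strong Feller property at $y$ and does not have the asymptotic e-property at $y$ (and, a fortiori, does not have the e-property at $y$).
   Context: Let $(X,\varrho)$ be a nonempty metric space. $\mathcal{M}_\varrho(X)$ is the set of all finite positive Borel measures on $X$; $B_b(X)$ is the set of all real bounded Borel functions on $X$; $C_b(X)\subset B_b(X)$ is the set of all real bounded continuous functions; $L_b(X)$ is the set of all real bounded Lipschitz-continuous functions on $X$; $\delta_x$ is the Dirac measure at $x$. Markov semigroup: a family $(\mathscr{P}_t)_{t\ge0}$ of positively homogeneous and additive maps $\mathscr{P}_t:\mathcal{M}_\varrho(X)\to\mathcal{M}_\varrho(X)$ which is a semigroup ($\mathscr{P}_0=\mathrm{id}$, $\mathscr{P}_{s+t}=\mathscr{P}_s\circ\mathscr{P}_t$ for $s,t\ge 0$) and satisfies $\mathscr{P}_t\mu(X)=\mu(X)$ for every $\mu\in\mathcal{M}_\varrho(X)$ and $t\ge0$. No continuity or measurability in $t$ is required. Markov-Feller semigroup: a Markov semigroup $(\mathscr{P}_t)_{t\ge0}$ for which there exists a semigroup $(\mathscr{U}_t)_{t\ge0}$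 of maps $\mathscr{U}_t:B_b(X)\to B_b(X)$ such that $\mathscr{U}_tC_b(X)\subset C_b(X)$ and $(\mathscr{U}_t)$ is dual to $(\mathscr{P}_t)$, i.e. $\int_X\mathscr{U}_t\varphi\,\mathrm{d}\mu=\int_X\varphi\,\mathrm{d}\mathscr{P}_t\mu$ for all $t\ge0$, $\mu\in\mathcal{M}_\varrho(X)$, $\varphi\in B_b(X)$. e-property at $y\in X$: for every $f\in L_b(X)$, $\lim_{x\to y}\sup_{t\ge0}|\mathscr{U}_tf(y)-\mathscr{U}_tf(x)|=0$. Asymptotic e-property at $y\in X$: for every $f\in L_b(X)$, $\lim_{x\to y}\limsup_{t\to\infty}|\mathscr{U}_tf(y)-\mathscr{U}_tf(x)|=0$, where $t$ ranges over real numbers. For a pseudo-metric $\sigma$ on $X$, $Lip_\sigma(1)=\{\varphi:X\to\mathbb{R}\mid |\varphi(x)-\varphi(y)|\le\sigma(x,y)\ \forall x,y\in X\}$. For a $\varrho$-continuous pseudo-metric $\sigma$ on $X$ and $\mu_1,\mu_2\in\mathcal{M}_\varrho(X)$ put $\|\mu_1-\mu_2\|_\sigma=\sup_{\varphi\in Lip_\sigma(1)}\left|\int_X\varphi\,\mathrm{d}(\mu_1-\mu_2)\right|$. Totally separating system of pseudo-metrics: an increasing sequence $(\varrho_n:X\times X\to[0,\infty))_{n\in\mathbb{N}}$ of pseudo-metrics, continuous with respect to $(X,\varrho)$, such that $\varrho_n(x,y)\to1$ as $n\to\infty$ for every $x\ne y$. Asymptotic strong Feller property at $y\in X$: there exist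 a sequence $(t_n)_{n\in\mathbb{N}}$ of positive reals and a totally separating system of pseudo-metrics $(\varrho_n)_{n\in\mathbb{N}}$ on $X$ such that $$\lim_{\gamma\to0^+}\limsup_{n\to\infty}\sup_{x\in B_\varrho(y,\gamma)}\|\mathscr{P}_{t_n}\delta_y-\mathscr{P}_{t_n}\delta_x\|_{\varrho_n}=0,$$ where $B_\varrho(y,\gamma)=\{x\in X:\varrho(x,y)<\gamma\}$. *)

theory Defs
  imports "HOL-Probability.Giry_Monad"
begin

text \<open>
  Everything is stated for the metric and the Borel sets supplied by the type class
  \<^class>\<open>metric_space\<close>. Normed spaces are types of class \<^class>\<open>real_normed_vector\<close>, whose metric
  is \<open>dist x y = norm (x - y)\<close>. A complex normed space is an instance of that class by restriction
  of scalars, with the same norm, and none of the notions below mentions the scalars.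
\<close>

definition finite_borel_measures :: "'a::topological_space measure set" where
  "finite_borel_measures = {\<mu>. sets \<mu> = sets borel \<and> finite_measure \<mu>}"

definition bounded_borel :: "('a::topological_space \<Rightarrow> real) set" where
  "bounded_borel = {f. f \<in> borel_measurable borel \<and> bounded (range f)}"

definition bounded_cont :: "('a::topological_space \<Rightarrow> real) set" where
  "bounded_cont = {f. continuous_on UNIV f \<and> bounded (range f)}"

definition bounded_lipschitz :: "('a::metric_space \<Rightarrow> real) set" where
  "bounded_lipschitz = {f. (\<exists>L. L-lipschitz_on UNIV f) \<and> bounded (range f)}"

definition add_measure :: "'a measure \<Rightarrow> 'a measure \<Rightarrow> 'a measure" where
  "add_measure \<mu> \<nu> = measure_of (space \<mu>) (sets \<mu>) (\<lambda>A. emeasure \<mu> A + emeasure \<nu> A)"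

lemma sets_add_measure [simp]: "sets (add_measure \<mu> \<nu>) = sets \<mu>"
  by (simp add: add_measure_def)

lemma emeasure_add_measure:
  assumes "sets \<nu> = sets \<mu>" "A \<in> sets \<mu>"
  shows "emeasure (add_measure \<mu> \<nu>) A = emeasure \<mu> A + emeasure \<nu> A"
  unfolding add_measure_def
proof (rule emeasure_measure_of_sigma)
  show "sigma_algebra (space \<mu>) (sets \<mu>)" ..
  show "positive (sets \<mu>) (\<lambda>A. emeasure \<mu> A + emeasure \<nu> A)"
    by (simp add: positive_def)
  show "countably_additive (sets \<mu>) (\<lambda>A. emeasure \<mu> A + emeasure \<nu> A)"
    using assms(1) by (auto simp: countably_additive_def suminf_add[symmetric] suminf_emeasure)
qed fact

text \<open>
  Operators are total functions in HOL; only their values on \<^const>\<open>finite_borel_measures\<close>,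
  respectively \<^const>\<open>bounded_borel\<close>, and at times \<open>t \<ge> 0\<close> are constrained.
\<close>

definition markov_semigroup ::
    "(real \<Rightarrow> 'a::topological_space measure \<Rightarrow> 'a measure) \<Rightarrow> bool" where
  "markov_semigroup P \<longleftrightarrow>
     (\<forall>t\<ge>0. \<forall>\<mu>\<in>finite_borel_measures. P t \<mu> \<in> finite_borel_measures) \<and>
     (\<forall>t\<ge>0. \<forall>c\<ge>0. \<forall>\<mu>\<in>finite_borel_measures.
        P t (scale_measure (ennreal c) \<mu>) = scale_measure (ennreal c) (P t \<mu>)) \<and>
     (\<forall>t\<ge>0. \<forall>\<mu>\<in>finite_borel_measures. \<forall>\<nu>\<in>finite_borel_measures.
        P t (add_measure \<mu> \<nu>) = add_measure (P t \<mu>) (P t \<nu>)) \<and>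
     (\<forall>\<mu>\<in>finite_borel_measures. P 0 \<mu> = \<mu>) \<and>
     (\<forall>s\<ge>0. \<forall>t\<ge>0. \<forall>\<mu>\<in>finite_borel_measures. P (s + t) \<mu> = P s (P t \<mu>)) \<and>
     (\<forall>t\<ge>0. \<forall>\<mu>\<in>finite_borel_measures. emeasure (P t \<mu>) UNIV = emeasure \<mu> UNIV)"

definition feller_dual_semigroup ::
    "(real \<Rightarrow> 'a::topological_space measure \<Rightarrow> 'a measure) \<Rightarrow>
     (real \<Rightarrow> ('a \<Rightarrow> real) \<Rightarrow> ('a \<Rightarrow> real)) \<Rightarrow> bool" where
  "feller_dual_semigroup P U \<longleftrightarrow>
     (\<forall>t\<ge>0. \<forall>f\<in>bounded_borel. U t f \<in> bounded_borel) \<and>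
     (\<forall>f\<in>bounded_borel. U 0 f = f) \<and>
     (\<forall>s\<ge>0. \<forall>t\<ge>0. \<forall>f\<in>bounded_borel. U (s + t) f = U s (U t f)) \<and>
     (\<forall>t\<ge>0. \<forall>f\<in>bounded_cont. U t f \<in> bounded_cont) \<and>
     (\<forall>t\<ge>0. \<forall>\<mu>\<in>finite_borel_measures. \<forall>f\<in>bounded_borel.
        (\<integral>x. U t f x \<partial>\<mu>) = (\<integral>x. f x \<partial>(P t \<mu>)))"

definition markov_feller_semigroup ::
    "(real \<Rightarrow> 'a::topological_space measure \<Rightarrow> 'a measure) \<Rightarrow> bool" where
  "markov_feller_semigroup P \<longleftrightarrow> markov_semigroup P \<and> (\<exists>U. feller_dual_semigroup P U)"

text \<open>
  The dual semigroup is unique on bounded Borel functions, so a property of \<open>P\<close> may be stated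
  through any \<open>U\<close> dual to it.
\<close>

lemma feller_dual_semigroup_unique:
  fixes P :: "real \<Rightarrow> 'a::topological_space measure \<Rightarrow> 'a measure"
  assumes "feller_dual_semigroup P U" "feller_dual_semigroup P V" "t \<ge> 0" "f \<in> bounded_borel"
  shows "U t f = V t f"
proof
  fix x :: 'a
  have fin: "return borel x \<in> finite_borel_measures"
    using prob_space_return[of x borel]
    by (simp add: finite_borel_measures_def prob_space_def)
  have "U t f \<in> borel_measurable borel" "V t f \<in> borel_measurable borel"
    using assms by (auto simp: feller_dual_semigroup_def bounded_borel_def)
  then have "U t f x = (\<integral>z. U t f z \<partial>return borel x)" "V t f x = (\<integral>z. V t f z \<partial>return borel x)"
    by (simp_all add: integral_return)
  moreover have "(\<integral>z. U t f z \<partial>return borel x) = (\<integral>z. V t f z \<partial>return borel x)"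
    using assms fin by (simp add: feller_dual_semigroup_def)
  ultimately show "U t f x = V t f x"
    by simp
qed

text \<open>Suprema and upper limits are taken in \<^typ>\<open>ereal\<close>, where they always exist.\<close>

definition e_property_at ::
    "(real \<Rightarrow> ('a::metric_space \<Rightarrow> real) \<Rightarrow> ('a \<Rightarrow> real)) \<Rightarrow> 'a \<Rightarrow> bool" where
  "e_property_at U y \<longleftrightarrow>
     (\<forall>f\<in>bounded_lipschitz.
        ((\<lambda>x. SUP t\<in>{0..}. ereal \<bar>U t f y - U t f x\<bar>) \<longlongrightarrow> 0) (at y))"

definition asymptotic_e_property_at ::
    "(real \<Rightarrow> ('a::metric_space \<Rightarrow> real) \<Rightarrow> ('a \<Rightarrow> real)) \<Rightarrow> 'a \<Rightarrow> bool" where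
  "asymptotic_e_property_at U y \<longleftrightarrow>
     (\<forall>f\<in>bounded_lipschitz.
        ((\<lambda>x. Limsup at_top (\<lambda>t::real. ereal \<bar>U t f y - U t f x\<bar>)) \<longlongrightarrow> 0) (at y))"

definition pseudo_metric :: "('a \<Rightarrow> 'a \<Rightarrow> real) \<Rightarrow> bool" where
  "pseudo_metric \<sigma> \<longleftrightarrow>
     (\<forall>x y. 0 \<le> \<sigma> x y) \<and> (\<forall>x. \<sigma> x x = 0) \<and> (\<forall>x y. \<sigma> x y = \<sigma> y x) \<and>
     (\<forall>x y z. \<sigma> x z \<le> \<sigma> x y + \<sigma> y z)"

definition Lip1 :: "('a \<Rightarrow> 'a \<Rightarrow> real) \<Rightarrow> ('a \<Rightarrow> real) set" where
  "Lip1 \<sigma> = {\<phi>. \<forall>x y. \<bar>\<phi> x - \<phi> y\<bar> \<le> \<sigma> x y}"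

text \<open>
  Below, \<open>\<sigma>\<close> is always continuous and bounded by 1, so every \<open>\<phi> \<in> Lip1 \<sigma>\<close> is bounded and
  continuous, and both integrals are proper for finite Borel measures.
\<close>

definition pm_distance ::
    "('a \<Rightarrow> 'a \<Rightarrow> real) \<Rightarrow> 'a measure \<Rightarrow> 'a measure \<Rightarrow> ereal" where
  "pm_distance \<sigma> \<mu> \<nu> = (SUP \<phi>\<in>Lip1 \<sigma>. ereal \<bar>(\<integral>x. \<phi> x \<partial>\<mu>) - (\<integral>x. \<phi> x \<partial>\<nu>)\<bar>)"

definition totally_separating :: "(nat \<Rightarrow> 'a::metric_space \<Rightarrow> 'a \<Rightarrow> real) \<Rightarrow> bool" where
  "totally_separating \<rho> \<longleftrightarrow>
     (\<forall>n. pseudo_metric (\<rho> n) \<and> continuous_on UNIV (\<lambda>(x, y). \<rho> n x y)) \<and>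
     (\<forall>x y. incseq (\<lambda>n. \<rho> n x y)) \<and>
     (\<forall>x y. x \<noteq> y \<longrightarrow> (\<lambda>n. \<rho> n x y) \<longlonglongrightarrow> 1)"

definition asymptotic_strong_feller_at ::
    "(real \<Rightarrow> 'a::metric_space measure \<Rightarrow> 'a measure) \<Rightarrow> 'a \<Rightarrow> bool" where
  "asymptotic_strong_feller_at P y \<longleftrightarrow>
     (\<exists>(\<tau> :: nat \<Rightarrow> real) \<rho>. (\<forall>n. 0 < \<tau> n) \<and> totally_separating \<rho> \<and>
        ((\<lambda>\<gamma>. limsup (\<lambda>n. SUP x\<in>ball y \<gamma>.
            pm_distance (\<rho> n) (P (\<tau> n) (return borel y)) (P (\<tau> n) (return borel x))))
          \<longlongrightarrow> 0) (at_right 0))"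

end

theory Submission
  imports Defs
begin

text \<open>
  Only the additive group of times matters, since nothing is required of \<open>t \<mapsto> P\<^sub>t\<close> beyond the
  semigroup law. Take a \<open>\<rat>\<close>-linear \<open>a : \<real> \<rightarrow> \<real>\<close> with \<open>a 1 = 0\<close> and \<open>a \<omega> = -1\<close> for some irrational
  \<open>\<omega> \<in> (0, 1)\<close>, and let \<open>P\<^sub>t\<close> be the push-forward under the dilation \<open>x \<mapsto> 2\<^bsup>a t\<^esup> x\<close>. Along the times
  \<open>1 + n \<omega>\<close> the dilations have factor \<open>2\<^bsup>-n\<^esup>\<close>, which beats the system \<open>min 1 (n \<parallel>x - y\<parallel>)\<close> and gives
  the asymptotic strong Feller property. The times \<open>m - k \<omega>\<close> are arbitrarily large for each fixed
  \<open>k\<close> and have dilation factor \<open>2\<^sup>k\<close>, where \<open>z \<mapsto> cos (\<pi> \<parallel>z\<parallel> / \<parallel>v\<parallel>)\<close>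
  takes the values \<open>1\<close> and \<open>-1\<close> at the images of \<open>y\<close> and \<open>y + 2\<^bsup>-k\<^esup> v\<close>, with \<open>v = y\<close> if \<open>y \<noteq> 0\<close>
  and any \<open>v \<noteq> 0\<close> otherwise.
\<close>

section \<open>A discontinuous additive function of time\<close>

text \<open>An irrational \<open>\<omega>\<close> and \<open>1\<close> are linearly independent over
  the rationals, so values at both can be prescribed and extended to a rational-linear map on the
  reals.\<close>

lemma exists_additive_nonlinear:
  obtains a :: "real \<Rightarrow> real" and \<omega> :: real
  where "\<And>s t. a (s + t) = a s + a t" "a 1 = 0" "a \<omega> = -1" "0 < \<omega>"
proof -
  let ?s = "\<lambda>(q::rat) (x::real). of_rat q * x"
  interpret Q: vector_space ?s
    by unfold_locales (auto simp: algebra_simps of_rat_add of_rat_mult)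
  interpret QQ: vector_space_pair ?s ?s ..
  have "\<not> {0<..<1::real} \<subseteq> \<rat>"
    using countable_subset[OF _ countable_rat] uncountable_open_interval[of 0 "1::real"] by auto
  then obtain \<omega> :: real where \<omega>: "0 < \<omega>" "\<omega> \<notin> \<rat>"
    unfolding subset_iff greaterThanLessThan_iff by blast
  \<comment> \<open>The rational span of \<open>1\<close> is the set of rationals itself.\<close>
  then have "\<omega> \<notin> Q.span {1}" "\<omega> \<noteq> 1"
    by (auto simp: Q.span_singleton)
  then have "Q.independent {\<omega>, 1}"
    by (intro Q.independent_insertI) (auto simp: Q.independent_empty)
  from QQ.linear_independent_extend[OF this, of "\<lambda>x. if x = 1 then 0 else -1"]
  obtain a where a: "Vector_Spaces.linear ?s ?s a" "a \<omega> = -1" "a 1 = 0"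
    using \<open>\<omega> \<noteq> 1\<close> by auto
  show thesis
    using a \<omega> QQ.linear_add[OF a(1)] by (intro that[of a \<omega>]) auto
qed

lemma additive_of_nat_mult:
  fixes a :: "real \<Rightarrow> real"
  assumes "\<And>s t. a (s + t) = a s + a t"
  shows "a (of_nat n * x) = of_nat n * a x"
proof (induction n)
  case 0
  show ?case using assms[of 0 0] by simp
next
  case (Suc n)
  then show ?case by (simp add: algebra_simps assms)
qed

section \<open>Semigroups induced by continuous flows\<close>

text \<open>The dual of push-forward is composition with \<open>T t\<close>: duality is the change
  of variables formula, and continuity of \<open>T t\<close> makes composition preserve bounded
  continuous functions.\<close>

lemma markov_feller_pushforward:
  fixes T :: "real \<Rightarrow> 'a::topological_space \<Rightarrow> 'a"
  assumes cont: "\<And>t. continuous_on UNIV (T t)"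
    and T0: "\<And>x. T 0 x = x"
    and T_add: "\<And>s t x. T (s + t) x = T s (T t x)"
  defines "P \<equiv> \<lambda>t \<mu>. distr \<mu> borel (T t)"
    and "U \<equiv> \<lambda>t f x. f (T t x)"
  shows "markov_feller_semigroup P" "feller_dual_semigroup P U"
proof -
  have T[measurable]: "T t \<in> borel_measurable borel" for t
    using cont by (rule borel_measurable_continuous_onI)
  have fin: "finite_measure \<mu>" "sets \<mu> = sets borel" "space \<mu> = UNIV" "T t \<in> borel_measurable \<mu>"
    if "\<mu> \<in> finite_borel_measures" for \<mu> t
    using that sets_eq_imp_space_eq[of \<mu> borel] measurable_cong_sets[of \<mu> borel borel borel]
    by (auto simp: finite_borel_measures_def)
  have fin_distr: "P t \<mu> \<in> finite_borel_measures" if "\<mu> \<in> finite_borel_measures" for t \<mu>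
    using fin[OF that] by (auto simp: finite_borel_measures_def P_def
      intro!: finite_measure.finite_measure_distr)
  have scale: "P t (scale_measure (ennreal c) \<mu>) = scale_measure (ennreal c) (P t \<mu>)"
    if \<mu>: "\<mu> \<in> finite_borel_measures" for t c \<mu>
  proof (rule measure_eqI)
    fix A assume "A \<in> sets (P t (scale_measure (ennreal c) \<mu>))"
    then show "emeasure (P t (scale_measure (ennreal c) \<mu>)) A
        = emeasure (scale_measure (ennreal c) (P t \<mu>)) A"
      using fin[OF \<mu>] by (simp add: P_def emeasure_distr space_scale_measure measurable_def)
  qed (simp add: P_def)
  have add: "P t (add_measure \<mu> \<nu>) = add_measure (P t \<mu>) (P t \<nu>)"
    if \<mu>: "\<mu> \<in> finite_borel_measures" and \<nu>: "\<nu> \<in> finite_borel_measures" for t \<mu> \<nu>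
  proof (rule measure_eqI)
    fix A assume "A \<in> sets (P t (add_measure \<mu> \<nu>))"
    then have A: "A \<in> sets borel" by (simp add: P_def)
    have sp: "space (add_measure \<mu> \<nu>) = UNIV"
      using sets_eq_imp_space_eq[of "add_measure \<mu> \<nu>" \<mu>] fin[OF \<mu>] by simp
    have "T t \<in> borel_measurable (add_measure \<mu> \<nu>)"
      using fin[OF \<mu>] T by (subst measurable_cong_sets[of _ borel _ borel]) auto
    moreover have "T t -` A \<in> sets borel"
      using measurable_sets[OF T[of t] A] by simp
    ultimately show "emeasure (P t (add_measure \<mu> \<nu>)) A = emeasure (add_measure (P t \<mu>) (P t \<nu>)) A"
      using fin[OF \<mu>] fin[OF \<nu>] A sp by (simp add: P_def emeasure_distr emeasure_add_measure)
  qed (simp add: P_def)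
  have ms: "markov_semigroup P"
    unfolding markov_semigroup_def
  proof (intro conjI ballI allI impI)
    fix \<mu> :: "'a measure" assume \<mu>: "\<mu> \<in> finite_borel_measures"
    show "P 0 \<mu> = \<mu>"
      using fin[OF \<mu>] T0 distr_id2[of borel \<mu>] by (simp add: P_def cong: distr_cong)
    fix s t :: real
    show "P (s + t) \<mu> = P s (P t \<mu>)"
      using fin[OF \<mu>] T_add by (simp add: P_def distr_distr o_def cong: distr_cong)
    show "emeasure (P t \<mu>) UNIV = emeasure \<mu> UNIV"
      using fin[OF \<mu>] by (simp add: P_def emeasure_distr)
  qed (auto simp: fin_distr scale add)
  show dual: "feller_dual_semigroup P U"
    unfolding feller_dual_semigroup_def
  proof (intro conjI ballI allI impI)
    fix t :: real and f :: "'a \<Rightarrow> real"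
    have bdd: "bounded (range (U t f))" if "bounded (range f)"
      using that by (rule bounded_subset) (auto simp: U_def)
    show "U t f \<in> bounded_borel" if "f \<in> bounded_borel"
      using that bdd measurable_compose[OF T, of f borel] by (auto simp: bounded_borel_def U_def)
    show "U t f \<in> bounded_cont" if "f \<in> bounded_cont"
      using that bdd continuous_on_compose2[OF _ cont, of UNIV f]
      by (auto simp: bounded_cont_def U_def)
    show "U 0 f = f" by (simp add: U_def T0)
    \<comment> \<open>Composition reverses the order of the two maps; commutativity of time addition
      restores it.\<close>
    show "U (s + t) f = U s (U t f)" for s
      using T_add by (simp add: U_def add.commute[of s])
    show "(\<integral>x. U t f x \<partial>\<mu>) = (\<integral>x. f x \<partial>(P t \<mu>))"
      if "\<mu> \<in> finite_borel_measures" "f \<in> bounded_borel" for \<mu>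
      using fin[OF that(1)] that(2) by (simp add: P_def U_def integral_distr bounded_borel_def)
  qed
  show "markov_feller_semigroup P"
    using ms dual by (auto simp: markov_feller_semigroup_def)
qed

section \<open>Contraction and the asymptotic strong Feller property\<close>

text \<open>For distinct points the limit \<open>1\<close> is attained once \<open>n\<close> reaches
  \<open>1 / dist x y\<close>, and truncation at \<open>1\<close> preserves the triangle
  inequality.\<close>

lemma totally_separating_min_scaled_dist:
  "totally_separating (\<lambda>n (x::'a::metric_space) y. min 1 (real n * dist x y))"
  unfolding totally_separating_def
proof (intro conjI allI impI)
  fix n :: nat
  show "pseudo_metric (\<lambda>(x::'a) y. min 1 (real n * dist x y))"
    unfolding pseudo_metric_def
  proof (intro conjI allI)
    fix x y z :: 'a
    have "real n * dist x z \<le> real n * dist x y + real n * dist y z"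
      using mult_left_mono[OF dist_triangle, of "real n" x z y] by (simp add: algebra_simps)
    moreover have "0 \<le> real n * dist x y" "0 \<le> real n * dist y z" by auto
    ultimately show "min 1 (real n * dist x z) \<le> min 1 (real n * dist x y) + min 1 (real n * dist y z)"
      by linarith
  qed (auto simp: dist_commute)
  show "continuous_on UNIV (\<lambda>(x::'a, y). min 1 (real n * dist x y))"
    by (auto simp: case_prod_beta intro!: continuous_intros)
next
  fix x y :: 'a
  show "incseq (\<lambda>n. min 1 (real n * dist x y))"
    by (intro monoI min.mono mult_right_mono) auto
  assume "x \<noteq> y"
  then obtain N :: nat where N: "1 < real N * dist x y"
    using reals_Archimedean3[of "dist x y"] by auto
  have "1 \<le> real n * dist x y" if "N \<le> n" for n
  proof -
    have "real N * dist x y \<le> real n * dist x y"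
      using that by (intro mult_right_mono) auto
    with N show ?thesis by linarith
  qed
  then have "\<forall>\<^sub>F n in sequentially. min 1 (real n * dist x y) = 1"
    by (intro eventually_sequentiallyI[of N]) (auto simp: min_def intro: antisym)
  then show "(\<lambda>n. min 1 (real n * dist x y)) \<longlonglongrightarrow> 1"
    by (rule tendsto_eventually)
qed

text \<open>Integrals against Dirac measures are evaluations, so the bound is the definition of
  \<open>Lip1\<close>. The comparison of \<open>\<sigma>\<close> with \<open>dist\<close> makes the
  test functions Lipschitz, hence Borel, which evaluation requires.\<close>

lemma pm_distance_return_le:
  fixes \<sigma> :: "'a::metric_space \<Rightarrow> 'a \<Rightarrow> real"
  assumes "\<And>x y. \<sigma> x y \<le> L * dist x y"
  shows "pm_distance \<sigma> (return borel x) (return borel y) \<le> ereal (\<sigma> x y)"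
  unfolding pm_distance_def
proof (rule SUP_least)
  fix \<phi> assume \<phi>: "\<phi> \<in> Lip1 \<sigma>"
  \<comment> \<open>A Lipschitz constant must be nonnegative, while \<open>L\<close> may have any
    sign.\<close>
  have "\<bar>\<phi> u - \<phi> v\<bar> \<le> max L 0 * dist u v" for u v
  proof -
    have "\<bar>\<phi> u - \<phi> v\<bar> \<le> L * dist u v"
      using \<phi> assms[of u v] unfolding Lip1_def by (smt (verit) mem_Collect_eq)
    also have "\<dots> \<le> max L 0 * dist u v" by (intro mult_right_mono) auto
    finally show ?thesis .
  qed
  then have "(max L 0)-lipschitz_on UNIV \<phi>"
    by (intro lipschitz_onI) (auto simp: dist_real_def)
  then have "continuous_on UNIV \<phi>" by (rule lipschitz_on_continuous_on)
  then have "\<phi> \<in> borel_measurable borel" by (rule borel_measurable_continuous_onI)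
  then show "ereal \<bar>(\<integral>z. \<phi> z \<partial>return borel x) - (\<integral>z. \<phi> z \<partial>return borel y)\<bar> \<le> ereal (\<sigma> x y)"
    using \<phi> by (simp add: integral_return Lip1_def)
qed

text \<open>The zero function lies in \<open>Lip1 \<sigma>\<close>, which rules out the value
  -\<infinity> of an empty supremum.\<close>

lemma pm_distance_nonneg:
  assumes "\<And>x y. 0 \<le> \<sigma> x y"
  shows "0 \<le> pm_distance \<sigma> \<mu> \<nu>"
  unfolding pm_distance_def using assms
  by (intro SUP_upper2[of "\<lambda>_. 0"]) (auto simp: Lip1_def)

text \<open>Dirac measures are pushed to Dirac measures, and the factor \<open>n\<close> in the
  pseudo-metric is absorbed by the contraction at time \<open>\<tau> n\<close>. Hence the supremum
  over a ball of radius \<open>\<gamma>\<close> is at most \<open>\<gamma>\<close>, uniformly in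
  \<open>n\<close>.\<close>

lemma asymptotic_strong_feller_at_contracting:
  fixes T :: "real \<Rightarrow> 'a::metric_space \<Rightarrow> 'a"
  assumes meas: "\<And>t. T t \<in> borel_measurable borel"
    and \<tau>: "\<And>n. 0 < \<tau> n"
    and contr: "\<And>n x y. real n * dist (T (\<tau> n) x) (T (\<tau> n) y) \<le> dist x y"
  shows "asymptotic_strong_feller_at (\<lambda>t \<mu>. distr \<mu> borel (T t)) y"
proof -
  let ?\<rho> = "\<lambda>n (x::'a) y. min 1 (real n * dist x y)"
  let ?D = "\<lambda>n x. pm_distance (?\<rho> n) (distr (return borel y) borel (T (\<tau> n)))
                    (distr (return borel x) borel (T (\<tau> n)))"
  let ?S = "\<lambda>\<gamma>. limsup (\<lambda>n. SUP x\<in>ball y \<gamma>. ?D n x)"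
  have D_le: "?D n x \<le> ereal (dist y x)" for n x
  proof -
    have "?D n x \<le> ereal (?\<rho> n (T (\<tau> n) y) (T (\<tau> n) x))"
      using pm_distance_return_le[of "?\<rho> n" "real n" "T (\<tau> n) y" "T (\<tau> n) x"]
      by (simp add: distr_return meas)
    also have "\<dots> \<le> ereal (dist y x)"
      using contr[of n y x] by (simp add: min.coboundedI2)
    finally show ?thesis .
  qed
  \<comment> \<open>For positive \<open>\<gamma>\<close> the ball contains \<open>y\<close>, so the
    supremum is not over the empty set.\<close>
  have lower: "0 \<le> ?S \<gamma>" if "\<gamma> > 0" for \<gamma>
  proof (rule le_Limsup)
    show "\<forall>\<^sub>F n in sequentially. 0 \<le> (SUP x\<in>ball y \<gamma>. ?D n x)"
      using that by (intro always_eventually allI SUP_upper2[of y] pm_distance_nonneg) auto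
  qed simp
  have upper: "?S \<gamma> \<le> ereal \<gamma>" for \<gamma>
  proof (intro Limsup_bounded always_eventually allI SUP_least)
    fix n x assume "x \<in> ball y \<gamma>"
    then have "ereal (dist y x) \<le> ereal \<gamma>" by simp
    with D_le show "?D n x \<le> ereal \<gamma>" by (rule order_trans)
  qed
  have "((\<lambda>\<gamma>::real. ereal \<gamma>) \<longlongrightarrow> 0) (at_right 0)"
    unfolding zero_ereal_def by (intro tendsto_intros)
  then have "(?S \<longlongrightarrow> 0) (at_right 0)"
    by (rule tendsto_sandwich[OF _ _ tendsto_const, rotated 2])
       (use lower upper in \<open>auto simp: eventually_at_right_less eventually_at_filter\<close>)
  then show ?thesis
    unfolding asymptotic_strong_feller_at_def
    using \<tau> totally_separating_min_scaled_dist by blast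
qed

section \<open>Expansion and the failure of the e-properties\<close>

lemma e_property_at_imp_asymptotic:
  fixes U :: "real \<Rightarrow> ('a::metric_space \<Rightarrow> real) \<Rightarrow> 'a \<Rightarrow> real"
  assumes "e_property_at U y"
  shows "asymptotic_e_property_at U y"
  unfolding asymptotic_e_property_at_def
proof
  fix f :: "'a \<Rightarrow> real" assume "f \<in> bounded_lipschitz"
  with assms have *: "((\<lambda>x. SUP t\<in>{0..}. ereal \<bar>U t f y - U t f x\<bar>) \<longlongrightarrow> 0) (at y)"
    by (auto simp: e_property_at_def)
  have "0 \<le> Limsup at_top (\<lambda>t::real. ereal \<bar>U t f y - U t f x\<bar>)" for x
    by (intro le_Limsup always_eventually) auto
  moreover have "Limsup at_top (\<lambda>t::real. ereal \<bar>U t f y - U t f x\<bar>)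
      \<le> (SUP t\<in>{0..}. ereal \<bar>U t f y - U t f x\<bar>)" for x
    by (intro Limsup_bounded eventually_mono[OF eventually_ge_at_top[of 0]] SUP_upper) auto
  ultimately show "((\<lambda>x. Limsup at_top (\<lambda>t::real. ereal \<bar>U t f y - U t f x\<bar>)) \<longlongrightarrow> 0) (at y)"
    by (intro tendsto_sandwich[OF _ _ tendsto_const *]) auto
qed

text \<open>The separating times may depend on \<open>k\<close>, but the gap \<open>c\<close> may
  not: it keeps the upper limit in time at least \<open>c\<close> along a sequence tending to
  \<open>y\<close>.\<close>

lemma not_asymptotic_e_property_atI:
  assumes f: "f \<in> bounded_lipschitz"
    and lim: "filterlim x (at y) sequentially"
    and c: "0 < c"
    and sep: "\<And>k. \<exists>\<^sub>F t in at_top. c \<le> \<bar>U t f y - U t f (x k)\<bar>"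
  shows "\<not> asymptotic_e_property_at U y"
proof
  let ?L = "\<lambda>x. Limsup at_top (\<lambda>t::real. ereal \<bar>U t f y - U t f x\<bar>)"
  assume "asymptotic_e_property_at U y"
  with f have "(?L \<longlongrightarrow> 0) (at y)"
    by (auto simp: asymptotic_e_property_at_def)
  then have "(\<lambda>k. ?L (x k)) \<longlonglongrightarrow> 0"
    using lim by (rule filterlim_compose)
  then have "\<forall>\<^sub>F k in sequentially. ?L (x k) < ereal c"
    using c by (intro order_tendstoD(2)) auto
  then obtain k where "?L (x k) < ereal c"
    using eventually_happens trivial_limit_sequentially by blast
  then have "\<forall>\<^sub>F t in at_top. ereal \<bar>U t f y - U t f (x k)\<bar> < ereal c"
    by (rule Limsup_lessD)
  with sep[of k] show False
    by (auto simp: frequently_def not_le)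
qed

lemma cos_norm_bounded_lipschitz:
  assumes "0 \<le> c"
  shows "(\<lambda>z::'a::real_normed_vector. cos (c * norm z)) \<in> bounded_lipschitz"
proof -
  have "\<bar>cos u - cos v\<bar> \<le> \<bar>u - v\<bar>" for u v :: real
  proof -
    \<comment> \<open>Sum-to-product, then one sine is bounded by \<open>1\<close> and the other by
      its argument.\<close>
    have "\<bar>cos u - cos v\<bar> = 2 * (\<bar>sin ((u + v) / 2)\<bar> * \<bar>sin ((v - u) / 2)\<bar>)"
      by (simp add: cos_diff_cos abs_mult)
    also have "\<dots> \<le> 2 * (1 * \<bar>(v - u) / 2\<bar>)"
      by (intro mult_left_mono mult_mono abs_sin_x_le_abs_x) auto
    finally show ?thesis by simp
  qed
  then have "\<bar>cos (c * norm x) - cos (c * norm y)\<bar> \<le> c * dist x y" for x y :: 'a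
  proof -
    have "\<bar>cos (c * norm x) - cos (c * norm y)\<bar> \<le> \<bar>c * norm x - c * norm y\<bar>" by fact
    also have "\<dots> = c * \<bar>norm x - norm y\<bar>"
      using assms by (simp add: abs_mult flip: right_diff_distrib)
    also have "\<dots> \<le> c * dist x y"
      using assms by (intro mult_left_mono) (auto simp: dist_norm norm_triangle_ineq3)
    finally show ?thesis .
  qed
  then have "c-lipschitz_on UNIV (\<lambda>z::'a. cos (c * norm z))"
    using assms by (intro lipschitz_onI) (auto simp: dist_real_def)
  moreover have "bounded (range (\<lambda>z::'a. cos (c * norm z)))"
    by (intro boundedI[of _ 1]) auto
  ultimately show ?thesis by (auto simp: bounded_lipschitz_def)
qed

lemma not_asymptotic_e_property_at_dilations:
  fixes T :: "real \<Rightarrow> 'a::real_normed_vector \<Rightarrow> 'a"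
  assumes "\<exists>v::'a. v \<noteq> 0"
    and dil: "\<And>k. \<exists>\<^sub>F t in at_top. T t = (\<lambda>x. (2 ^ k) *\<^sub>R x)"
  shows "\<not> asymptotic_e_property_at (\<lambda>t f x. f (T t x)) y"
proof -
  \<comment> \<open>Either way \<open>y\<close> lies on the line through \<open>v\<close>, so
    \<open>y\<close>, the nearby points and their dilates are all multiples of
    \<open>v\<close>.\<close>
  obtain v where v: "v \<noteq> 0" "y = 0 \<or> y = v"
    using assms(1) by (cases "y = 0") auto
  let ?f = "\<lambda>z::'a. cos (pi / norm v * norm z)"
  \<comment> \<open>The exponent \<open>Suc k\<close> makes the dilation factor even:
    \<open>y\<close> goes to an even multiple of \<open>v\<close> and \<open>?x k\<close> to the
    next odd one, where the cosine is \<open>1\<close> and \<open>-1\<close>.\<close>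
  let ?x = "\<lambda>k::nat. y + (1 / 2 ^ Suc k) *\<^sub>R v"
  have f_scale: "?f (r *\<^sub>R v) = cos (pi * \<bar>r\<bar>)" for r
    using v by simp
  have sep: "?f ((2 ^ Suc k) *\<^sub>R y) - ?f ((2 ^ Suc k) *\<^sub>R ?x k) = 2" for k
  proof -
    have 1: "cos (pi * 2 ^ Suc k) = 1" "cos (pi * (2 ^ Suc k + 1)) = -1"
      using cos_npi2[of "2 ^ Suc k"] cos_npi2[of "2 ^ Suc k + 1"] by (simp_all add: add.commute)
    from v(2) show ?thesis
    proof
      assume y: "y = 0"
      have "(2 ^ Suc k) *\<^sub>R ?x k = 1 *\<^sub>R v" "(2 ^ Suc k) *\<^sub>R y = 0 *\<^sub>R v"
        by (simp_all add: y)
      then show ?thesis by (simp only: f_scale) simp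
    next
      assume y: "y = v"
      have "(2 ^ Suc k) *\<^sub>R ?x k = (2 ^ Suc k + 1) *\<^sub>R v" "(2 ^ Suc k) *\<^sub>R y = (2 ^ Suc k) *\<^sub>R v"
        by (simp_all add: y scaleR_add_left scaleR_add_right)
      then show ?thesis using 1 by (simp only: f_scale) simp
    qed
  qed
  show ?thesis
  proof (rule not_asymptotic_e_property_atI[where f = ?f and x = ?x and c = 2])
    show "?f \<in> bounded_lipschitz"
      by (rule cos_norm_bounded_lipschitz) simp
    have "(\<lambda>k. (1 / 2) ^ Suc k :: real) \<longlonglongrightarrow> 0"
      by (intro LIMSEQ_Suc LIMSEQ_realpow_zero) auto
    then have "(\<lambda>k. y + ((1 / 2) ^ Suc k) *\<^sub>R v) \<longlonglongrightarrow> y + 0 *\<^sub>R v"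
      by (intro tendsto_intros)
    \<comment> \<open>The filter \<open>at y\<close> excludes \<open>y\<close>;
      \<open>v \<noteq> 0\<close> keeps every \<open>?x k\<close> away from it.\<close>
    then show "filterlim ?x (at y) sequentially"
      using v(1) by (intro filterlim_atI) (simp_all add: power_one_over)
    show "\<exists>\<^sub>F t in at_top. 2 \<le> \<bar>?f (T t y) - ?f (T t (?x k))\<bar>" for k
      using dil[of "Suc k"]
    proof (rule frequently_elim1)
      fix t assume "T t = (\<lambda>x. (2 ^ Suc k) *\<^sub>R x)"
      then show "2 \<le> \<bar>?f (T t y) - ?f (T t (?x k))\<bar>" using sep[of k] by simp
    qed
  qed simp
qed

section \<open>The semigroup of dilations along an additive function\<close>

theorem theorem2:
  assumes "\<exists>x :: 'a::real_normed_vector. x \<noteq> 0"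
  shows "\<exists>(P :: real \<Rightarrow> 'a measure \<Rightarrow> 'a measure) U.
           markov_feller_semigroup P \<and> feller_dual_semigroup P U \<and>
           (\<forall>y. asymptotic_strong_feller_at P y \<and>
                \<not> asymptotic_e_property_at U y \<and>
                \<not> e_property_at U y)"
proof -
  obtain a :: "real \<Rightarrow> real" and \<omega> :: real
    where a: "\<And>s t. a (s + t) = a s + a t" "a 1 = 0" "a \<omega> = -1" and \<omega>: "0 < \<omega>"
    using exists_additive_nonlinear by blast
  \<comment> \<open>The exponential turns additivity of \<open>a\<close> into the flow law for
    \<open>T\<close>.\<close>
  define T :: "real \<Rightarrow> 'a \<Rightarrow> 'a" where "T t x = (2 powr a t) *\<^sub>R x" for t x
  have a_diff: "a (s - t) = a s - a t" for s t
    using a(1)[of "s - t" t] by simp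
  have a_nat: "a (of_nat n) = 0" "a (of_nat n * \<omega>) = - of_nat n" for n
    using additive_of_nat_mult[of a n 1, OF a(1)] additive_of_nat_mult[of a n \<omega>, OF a(1)] a by simp_all
  have cont: "continuous_on UNIV (T t)" for t
    unfolding T_def by (intro continuous_intros)
  have feller: "markov_feller_semigroup (\<lambda>t \<mu>. distr \<mu> borel (T t))"
      "feller_dual_semigroup (\<lambda>t \<mu>. distr \<mu> borel (T t)) (\<lambda>t f x. f (T t x))"
    using a(1)[of 0 0] by (intro markov_feller_pushforward cont; simp add: T_def a powr_add)+
  have asf: "asymptotic_strong_feller_at (\<lambda>t \<mu>. distr \<mu> borel (T t)) y" for y
  proof (rule asymptotic_strong_feller_at_contracting)
    fix n :: nat and x y :: 'a
    show "T t \<in> borel_measurable borel" for t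
      using cont by (rule borel_measurable_continuous_onI)
    \<comment> \<open>The summand \<open>1\<close> makes the time positive at \<open>n = 0\<close>
      and leaves the dilation unchanged, since \<open>a 1 = 0\<close>.\<close>
    show "0 < 1 + real n * \<omega>"
      using \<omega> by (simp add: add_pos_nonneg)
    have "a (1 + real n * \<omega>) = - real n"
      using a a_nat by simp
    then have "dist (T (1 + real n * \<omega>) x) (T (1 + real n * \<omega>) y) = dist x y / 2 ^ n"
      by (simp add: T_def powr_minus powr_realpow dist_norm divide_inverse flip: scaleR_diff_right)
    moreover have "real n * dist x y \<le> 2 ^ n * dist x y"
      using of_nat_less_two_power[of n, where 'a = real] by (intro mult_right_mono) auto
    ultimately show "real n * dist (T (1 + real n * \<omega>) x) (T (1 + real n * \<omega>) y) \<le> dist x y"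
      by (simp add: divide_le_eq mult.commute)
  qed
  have nae: "\<not> asymptotic_e_property_at (\<lambda>t f x. f (T t x)) y" for y
  proof (rule not_asymptotic_e_property_at_dilations[OF assms])
    fix k :: nat
    show "\<exists>\<^sub>F t in at_top. T t = (\<lambda>x. (2 ^ k) *\<^sub>R x)"
      unfolding frequently_def eventually_at_top_linorder
    proof
      assume "\<exists>N. \<forall>t\<ge>N. T t \<noteq> (\<lambda>x. (2 ^ k) *\<^sub>R x)"
      then obtain N where N: "\<And>t. N \<le> t \<Longrightarrow> T t \<noteq> (\<lambda>x. (2 ^ k) *\<^sub>R x)" by auto
      \<comment> \<open>Since \<open>a\<close> vanishes at natural numbers, \<open>m\<close> can
        push the time beyond \<open>N\<close> while the exponent stays \<open>k\<close>.\<close>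
      obtain m :: nat where "N + real k * \<omega> \<le> real m"
        using real_arch_simple by blast
      moreover have "T (real m - real k * \<omega>) = (\<lambda>x. (2 ^ k) *\<^sub>R x)"
        by (simp add: T_def fun_eq_iff a_diff a_nat powr_realpow)
      ultimately show False using N[of "real m - real k * \<omega>"] by simp
    qed
  qed
  show ?thesis
    using feller asf nae e_property_at_imp_asymptotic by blast
qed

end
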